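(* Let $B_n$ be the Artin braid group with identity $e$ and generators $\sigma_1,\ldots,\sigma_{n-1}$ satisfying $$(\mathrm{a})\quad \sigma_i\sigma_{i+1}\sigma_i=\sigma_{i+1}\sigma_i\sigma_{i+1},\quad 1\le i\le n-2,\qquad\qquad (\mathrm{b})\quad \sigma_i\sigma_j=\sigma_j\sigma_i,\quad |i-j|\ge 2.$$ For $i,j\in\{1,\ldots,n-1\}$ let $$\Sigma_{ij}(2)=\begin{pmatrix}0 & \sigma_i\\ \sigma_j & 0\end{pmatrix},\qquad E(2)=\begin{pmatrix}0 & e\\ e & 0\end{pmatrix}.$$ Then the relations for the matrix generators $\Sigma_{ij}(2)$ corresponding to the braid group relations (a) and (b), respectively, have the form $$\mu_3[\Sigma_{i,i+1}(2),\Sigma_{i,i+1}(2),\Sigma_{i,i+1}(2)]=\mu_3[\Sigma_{i+1,i}(2),\Sigma_{i+1,i}(2),\Sigma_{i+1,i}(2)]=q_i^{[3]}E(2),\quad 1\le i\le n-2,$$ $$\mu_3[\Sigma_{ij}(2),\Sigma_{ij}(2),E(2)]=\mu_3[\Sigma_{ji}(2),\Sigma_{ji}(2),E(2)],\quad |i-j|\ge 2,$$ where $q_i^{[3]}=\sigma_i\sigma_{i+1}\sigma_i=\sigma_{i+1}\sigma_i\sigma_{i+1}$.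
   Context: Here $\mu_3[M_1,M_2,M_3]=M_1M_2M_3$ is the ordinary product of three anti-diagonal $2\times2$ matrices with entries in $B_n$ (and formal zeros on the diagonal), and $q\,E(2)$ denotes the matrix $\begin{pmatrix}0&q\\ q&0\end{pmatrix}$ for $q\in B_n$. That the matrix relations correspond to the braid group relations means that the matrices $\Sigma_{ij}(2)$ satisfy them and that, written out in components (entries), the first family of matrix relations gives the relations (a) and the second family gives the relations (b). *)

theory Defs
  imports "HOL-Algebra.Group" "HOL-Analysis.Finite_Cartesian_Product"
begin

section \<open>Groups given by generators and relations\<close>

text \<open>The letter \<open>(x, True)\<close> stands for the generator \<open>x\<close>, and \<open>(x, False)\<close> for its
  formal inverse.\<close>

type_synonym 'g word = "('g \<times> bool) list"

definition words :: "'g set \<Rightarrow> 'g word set"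
  where "words X = lists (X \<times> UNIV)"

text \<open>The least congruence on words over \<open>X\<close> that allows free cancellation and contains the
  relations \<open>R\<close>; a pair \<open>(r, s)\<close> in \<open>R\<close> is the relation \<open>r = s\<close>.\<close>

inductive_set pres_cong :: "'g set \<Rightarrow> ('g word \<times> 'g word) set \<Rightarrow> ('g word \<times> 'g word) set"
  for X :: "'g set" and R :: "('g word \<times> 'g word) set" where
  cong_refl: "u \<in> words X \<Longrightarrow> (u, u) \<in> pres_cong X R"
| cong_sym: "(u, v) \<in> pres_cong X R \<Longrightarrow> (v, u) \<in> pres_cong X R"
| cong_trans: "(u, v) \<in> pres_cong X R \<Longrightarrow> (v, w) \<in> pres_cong X R \<Longrightarrow> (u, w) \<in> pres_cong X R"
| cancel: "u \<in> words X \<Longrightarrow> v \<in> words X \<Longrightarrow> x \<in> X \<Longrightarrow>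
    (u @ [(x, b), (x, \<not> b)] @ v, u @ v) \<in> pres_cong X R"
| rel: "u \<in> words X \<Longrightarrow> v \<in> words X \<Longrightarrow> r \<in> words X \<Longrightarrow> s \<in> words X \<Longrightarrow> (r, s) \<in> R \<Longrightarrow>
    (u @ r @ v, u @ s @ v) \<in> pres_cong X R"

definition presented_group :: "'g set \<Rightarrow> ('g word \<times> 'g word) set \<Rightarrow> 'g word set monoid"
  where "presented_group X R =
    \<lparr>carrier = words X // pres_cong X R,
     monoid.mult = (\<lambda>A B. \<Union>u\<in>A. \<Union>v\<in>B. pres_cong X R `` {u @ v}),
     one = pres_cong X R `` {[]}\<rparr>"

definition pres_gen :: "'g set \<Rightarrow> ('g word \<times> 'g word) set \<Rightarrow> 'g \<Rightarrow> 'g word set"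
  where "pres_gen X R x = pres_cong X R `` {[(x, True)]}"

lemma pres_cong_words: "(u, v) \<in> pres_cong X R \<Longrightarrow> u \<in> words X \<and> v \<in> words X"
  by (induction rule: pres_cong.induct) (auto simp: words_def)

lemma equiv_pres_cong: "equiv (words X) (pres_cong X R)"
proof (rule equivI)
  show "pres_cong X R \<subseteq> words X \<times> words X"
    using pres_cong_words by fastforce
  show "refl_on (words X) (pres_cong X R)"
    by (auto simp: refl_on_def intro: pres_cong.cong_refl)
  show "sym (pres_cong X R)"
    by (auto intro: symI pres_cong.cong_sym)
  show "trans (pres_cong X R)"
    by (rule transI) (rule pres_cong.cong_trans)
qed

lemma pres_cong_context:
  assumes "(u, v) \<in> pres_cong X R" "a \<in> words X" "c \<in> words X"
  shows "(a @ u @ c, a @ v @ c) \<in> pres_cong X R"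
  using assms
proof (induction rule: pres_cong.induct)
  case (cong_refl u)
  then show ?case by (intro pres_cong.cong_refl) (auto simp: words_def)
next
  case (cong_sym u v)
  then show ?case by (blast intro: pres_cong.cong_sym)
next
  case (cong_trans u v w)
  then show ?case by (blast intro: pres_cong.cong_trans)
next
  case (cancel u v x b)
  then show ?case
    using pres_cong.cancel[of "a @ u" X "v @ c" x b R] by (auto simp: words_def)
next
  case (rel u v r s)
  then show ?case
    using pres_cong.rel[of "a @ u" X "v @ c" r s R] by (auto simp: words_def)
qed

lemma pres_cong_append:
  assumes "(u, u') \<in> pres_cong X R" "(v, v') \<in> pres_cong X R"
  shows "(u @ v, u' @ v') \<in> pres_cong X R"
proof -
  have w: "u' \<in> words X" "v \<in> words X" "[] \<in> words X"
    using pres_cong_words[OF assms(1)] pres_cong_words[OF assms(2)] by (auto simp: words_def)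
  have "(u @ v, u' @ v) \<in> pres_cong X R"
    using pres_cong_context[OF assms(1) w(3) w(2)] by simp
  moreover have "(u' @ v, u' @ v') \<in> pres_cong X R"
    using pres_cong_context[OF assms(2) w(1) w(3)] by simp
  ultimately show ?thesis by (rule pres_cong.cong_trans)
qed

lemma pres_mult:
  assumes "u \<in> words X" "v \<in> words X"
  shows "pres_cong X R `` {u} \<otimes>\<^bsub>presented_group X R\<^esub> pres_cong X R `` {v}
    = pres_cong X R `` {u @ v}"
proof -
  have "(\<Union>v'\<in>pres_cong X R `` {v}. pres_cong X R `` {u' @ v'}) = pres_cong X R `` {u @ v}"
    if u': "(u, u') \<in> pres_cong X R" for u'
  proof (rule UN_equiv_class[OF equiv_pres_cong _ assms(2), THEN trans])
    show "(\<lambda>v'. pres_cong X R `` {u' @ v'}) respects pres_cong X R"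
      using u' pres_cong_words[OF u']
      by (intro congruentI equiv_class_eq[OF equiv_pres_cong] pres_cong_append pres_cong.cong_refl) auto
    show "pres_cong X R `` {u' @ v} = pres_cong X R `` {u @ v}"
      by (rule equiv_class_eq[OF equiv_pres_cong pres_cong.cong_sym[OF
            pres_cong_append[OF u' pres_cong.cong_refl[OF assms(2)]]]])
  qed
  moreover have "(u, u) \<in> pres_cong X R"
    using assms by (intro pres_cong.cong_refl)
  ultimately have "(\<Union>u'\<in>pres_cong X R `` {u}. \<Union>v'\<in>pres_cong X R `` {v}.
      pres_cong X R `` {u' @ v'}) = pres_cong X R `` {u @ v}"
    by (intro UN_constant_eq) auto
  then show ?thesis
    by (simp add: presented_group_def)
qed

lemma pres_inverse:
  assumes "u \<in> words X"
  shows "\<exists>u'\<in>words X. (u' @ u, []) \<in> pres_cong X R"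
  using assms
proof (induction u)
  case Nil
  then show ?case by (auto simp: words_def intro!: pres_cong.cong_refl bexI[of _ "[]"])
next
  case (Cons a u)
  obtain x b where a: "a = (x, b)" "x \<in> X"
    using Cons.prems by (cases a) (auto simp: words_def)
  have u: "u \<in> words X"
    using Cons.prems by (auto simp: words_def)
  then obtain u' where u': "u' \<in> words X" "(u' @ u, []) \<in> pres_cong X R"
    using Cons.IH by blast
  have "(u' @ [(x, \<not> b), (x, \<not> \<not> b)] @ u, u' @ u) \<in> pres_cong X R"
    by (rule pres_cong.cancel[OF u'(1) u a(2)])
  then have "((u' @ [(x, \<not> b)]) @ a # u, []) \<in> pres_cong X R"
    using pres_cong.cong_trans[OF _ u'(2)] a by simp
  moreover have "u' @ [(x, \<not> b)] \<in> words X"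
    using u' a by (auto simp: words_def)
  ultimately show ?case by blast
qed

lemma group_presented_group: "group (presented_group X R)"
proof (rule groupI)
  have nil: "[] \<in> words X" by (simp add: words_def)
  have app: "u @ v \<in> words X" if "u \<in> words X" "v \<in> words X" for u v
    using that by (simp add: words_def)
  let ?G = "presented_group X R" and ?c = "\<lambda>u. pres_cong X R `` {u}"
  have one: "\<one>\<^bsub>?G\<^esub> = ?c []" by (simp add: presented_group_def)
  have inC: "?c u \<in> carrier ?G" if "u \<in> words X" for u
    using that by (auto simp: presented_group_def quotient_def)
  have exC: "\<exists>u\<in>words X. A = ?c u" if "A \<in> carrier ?G" for A
    using that by (auto simp: presented_group_def quotient_def)
  show "\<one>\<^bsub>?G\<^esub> \<in> carrier ?G" using one inC nil by simp
  fix A assume "A \<in> carrier ?G"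
  then obtain u where u: "u \<in> words X" "A = ?c u" using exC by blast
  show "\<one>\<^bsub>?G\<^esub> \<otimes>\<^bsub>?G\<^esub> A = A" using pres_mult[OF nil u(1)] one u by simp
  obtain u' where u': "u' \<in> words X" "(u' @ u, []) \<in> pres_cong X R"
    using pres_inverse[OF u(1)] by blast
  have "?c u' \<otimes>\<^bsub>?G\<^esub> A = \<one>\<^bsub>?G\<^esub>"
    using pres_mult[OF u'(1) u(1)] one u equiv_class_eq[OF equiv_pres_cong u'(2)] by simp
  then show "\<exists>B\<in>carrier ?G. B \<otimes>\<^bsub>?G\<^esub> A = \<one>\<^bsub>?G\<^esub>" using inC[OF u'(1)] by blast
  fix B assume "B \<in> carrier ?G"
  then obtain v where v: "v \<in> words X" "B = ?c v" using exC by blast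
  show "A \<otimes>\<^bsub>?G\<^esub> B \<in> carrier ?G" using pres_mult[OF u(1) v(1)] u v inC app by simp
  fix C assume "C \<in> carrier ?G"
  then obtain w where w: "w \<in> words X" "C = ?c w" using exC by blast
  show "A \<otimes>\<^bsub>?G\<^esub> B \<otimes>\<^bsub>?G\<^esub> C = A \<otimes>\<^bsub>?G\<^esub> (B \<otimes>\<^bsub>?G\<^esub> C)"
    using u v w app by (simp add: pres_mult)
qed


section \<open>The Artin braid group\<close>

definition braid_rels :: "nat \<Rightarrow> (nat word \<times> nat word) set"
  where "braid_rels n =
    {([(i, True), (i + 1, True), (i, True)], [(i + 1, True), (i, True), (i + 1, True)]) | i.
        1 \<le> i \<and> i + 2 \<le> n} \<union>
    {([(i, True), (j, True)], [(j, True), (i, True)]) | i j.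
        i \<in> {1..<n} \<and> j \<in> {1..<n} \<and> \<bar>int i - int j\<bar> \<ge> 2}"

definition braid_group :: "nat \<Rightarrow> nat word set monoid"
  where "braid_group n = presented_group {1..<n} (braid_rels n)"

definition braid_gen :: "nat \<Rightarrow> nat \<Rightarrow> nat word set"
  where "braid_gen n i = pres_gen {1..<n} (braid_rels n) i"

lemma group_braid_group: "group (braid_group n)"
  by (simp add: braid_group_def group_presented_group)


section \<open>Two by two matrices over a group with a formal zero\<close>

text \<open>An entry \<open>None\<close> is the formal zero. It is absorbing for multiplication and neutral for
  addition. A group has no sum of two elements, so that sum is left unspecified; it is never formed
  in a product of anti-diagonal matrices, as each entry has at most one nonzero summand.\<close>

fun zmult :: "('a, 'b) monoid_scheme \<Rightarrow> 'a option \<Rightarrow> 'a option \<Rightarrow> 'a option" where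
  "zmult G (Some x) (Some y) = Some (x \<otimes>\<^bsub>G\<^esub> y)"
| "zmult G None _ = None"
| "zmult G _ None = None"

fun zadd :: "'a option \<Rightarrow> 'a option \<Rightarrow> 'a option" where
  "zadd None y = y"
| "zadd x None = x"
| "zadd (Some x) (Some y) = undefined"

definition mat_mult ::
    "('a, 'b) monoid_scheme \<Rightarrow> 'a option^2^2 \<Rightarrow> 'a option^2^2 \<Rightarrow> 'a option^2^2"
  where "mat_mult G A B =
    (\<chi> r c. zadd (zmult G (A $ r $ 1) (B $ 1 $ c)) (zmult G (A $ r $ 2) (B $ 2 $ c)))"

definition mu3 ::
    "('a, 'b) monoid_scheme \<Rightarrow> 'a option^2^2 \<Rightarrow> 'a option^2^2 \<Rightarrow> 'a option^2^2 \<Rightarrow> 'a option^2^2"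
  where "mu3 G A B C = mat_mult G (mat_mult G A B) C"

definition antidiag :: "'a \<Rightarrow> 'a \<Rightarrow> 'a option^2^2"
  where "antidiag a b =
    (\<chi> r c. if r = 1 \<and> c = 2 then Some a else if r = 2 \<and> c = 1 then Some b else None)"

definition Sigma2 :: "(nat \<Rightarrow> 'a) \<Rightarrow> nat \<Rightarrow> nat \<Rightarrow> 'a option^2^2"
  where "Sigma2 s i j = antidiag (s i) (s j)"

definition E2 :: "('a, 'b) monoid_scheme \<Rightarrow> 'a option^2^2"
  where "E2 G = antidiag \<one>\<^bsub>G\<^esub> \<one>\<^bsub>G\<^esub>"

definition scalar_mult :: "('a, 'b) monoid_scheme \<Rightarrow> 'a \<Rightarrow> 'a option^2^2 \<Rightarrow> 'a option^2^2"
  where "scalar_mult G q A = (\<chi> r c. zmult G (Some q) (A $ r $ c))"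

end

theory Submission
  imports Defs "HOL-Analysis.Cartesian_Space"
begin

text \<open>
  A product of two anti-diagonal matrices is diagonal, and a third anti-diagonal factor makes it
  anti-diagonal again. Along the way no entry has more than one nonzero summand, so the
  triple product is governed by multiplication in the group alone:
  \<open>\<mu>\<^sub>3\<close> takes \<open>(a, b), (c, d), (f, g)\<close> to \<open>(a d f, b c g)\<close>, if a pair lists the upper and the lower
  anti-diagonal entry (\<open>mu3_antidiag\<close>).

  For this reason the cube of \<open>(x, y)\<close> is \<open>(x y x, y x y)\<close>, the pair of the two sides of the braid
  relation, and the cube of \<open>(y, x)\<close> is the same pair exchanged. The two cubes agree exactly when
  the braid relation holds, and they are then \<open>(q, q)\<close>, the multiple by \<open>q\<close> of \<open>E(2) = (e, e)\<close>, where
  \<open>q\<close> is the common value of the two sides (\<open>mu3_cube_scalar_iff\<close>). In the same way the square of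
  \<open>(x, y)\<close> times \<open>(e, e)\<close> is \<open>(x y, y x)\<close>, and invariance under the exchange of \<open>x\<close> and \<open>y\<close> is
  commutation (\<open>mu3_square_swap_iff\<close>).

  These equivalences hold for arbitrary elements of a group. The braid group satisfies the matrix
  relations because its generators satisfy the relations of its presentation: products of
  generators are classes of positive words, and the relations identify the classes in question
  (\<open>braid_gen_braid_relation\<close>, \<open>braid_gen_commute\<close>).
\<close>

lemma antidiag_eq_iff: "antidiag a b = antidiag c d \<longleftrightarrow> a = c \<and> b = d"
  by (auto simp: antidiag_def vec_eq_iff forall_2)

text \<open>The middle factor is read from the other row: an anti-diagonal matrix exchanges the two
  coordinates, so a path from row 1 to column 2 through three factors runs
  \<open>1 \<rightarrow> 2 \<rightarrow> 1 \<rightarrow> 2\<close> and meets the upper, the lower and the upper entry in turn.\<close>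

lemma mu3_antidiag:
  "mu3 G (antidiag a b) (antidiag c d) (antidiag f g)
    = antidiag (a \<otimes>\<^bsub>G\<^esub> d \<otimes>\<^bsub>G\<^esub> f) (b \<otimes>\<^bsub>G\<^esub> c \<otimes>\<^bsub>G\<^esub> g)"
  by (simp add: mu3_def mat_mult_def antidiag_def vec_eq_iff forall_2)

lemma (in monoid) scalar_mult_E2:
  assumes "q \<in> carrier G"
  shows "scalar_mult G q (E2 G) = antidiag q q"
  using assms by (simp add: scalar_mult_def E2_def antidiag_def vec_eq_iff forall_2)

lemma mu3_cube_swap_iff:
  "mu3 G (antidiag x y) (antidiag x y) (antidiag x y)
      = mu3 G (antidiag y x) (antidiag y x) (antidiag y x)
    \<longleftrightarrow> x \<otimes>\<^bsub>G\<^esub> y \<otimes>\<^bsub>G\<^esub> x = y \<otimes>\<^bsub>G\<^esub> x \<otimes>\<^bsub>G\<^esub> y"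
  by (auto simp: mu3_antidiag antidiag_eq_iff)

text \<open>A multiple of \<open>E(2)\<close> has equal anti-diagonal entries. Those of the cube are the two sides of
  the braid relation, so its being the multiple by \<open>q\<close> pins both sides to \<open>q\<close>.\<close>

lemma (in monoid) mu3_cube_scalar_iff:
  assumes "q \<in> carrier G"
  shows "mu3 G (antidiag x y) (antidiag x y) (antidiag x y)
        = mu3 G (antidiag y x) (antidiag y x) (antidiag y x) \<and>
      mu3 G (antidiag y x) (antidiag y x) (antidiag y x) = scalar_mult G q (E2 G)
    \<longleftrightarrow> q = x \<otimes> y \<otimes> x \<and> q = y \<otimes> x \<otimes> y"
  using assms by (auto simp: mu3_antidiag antidiag_eq_iff scalar_mult_E2)

lemma (in monoid) mu3_square_swap_iff:
  assumes "x \<in> carrier G" "y \<in> carrier G"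
  shows "mu3 G (antidiag x y) (antidiag x y) (E2 G) = mu3 G (antidiag y x) (antidiag y x) (E2 G)
    \<longleftrightarrow> x \<otimes> y = y \<otimes> x"
  using assms by (auto simp: E2_def mu3_antidiag antidiag_eq_iff)

lemma pres_cong_class_relation:
  assumes "(r, s) \<in> R" "r \<in> words X" "s \<in> words X"
  shows "pres_cong X R `` {r} = pres_cong X R `` {s}"
proof (rule equiv_class_eq[OF equiv_pres_cong])
  show "(r, s) \<in> pres_cong X R"
    using pres_cong.rel[of "[]" X "[]" r s R] assms by (simp add: words_def)
qed

lemma braid_gen_in_carrier: "i \<in> {1..<n} \<Longrightarrow> braid_gen n i \<in> carrier (braid_group n)"
  by (auto simp: braid_gen_def pres_gen_def braid_group_def presented_group_def words_def
      intro!: quotientI)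

lemma braid_gen_mult:
  assumes "i \<in> {1..<n}" "j \<in> {1..<n}"
  shows "braid_gen n i \<otimes>\<^bsub>braid_group n\<^esub> braid_gen n j
    = pres_cong {1..<n} (braid_rels n) `` {[(i, True), (j, True)]}"
  using assms
    pres_mult[of "[(i, True)]" "{1..<n}" "[(j, True)]" "braid_rels n"]
  by (simp add: braid_gen_def pres_gen_def braid_group_def words_def)

lemma braid_gen_mult3:
  assumes "i \<in> {1..<n}" "j \<in> {1..<n}" "k \<in> {1..<n}"
  shows "braid_gen n i \<otimes>\<^bsub>braid_group n\<^esub> braid_gen n j \<otimes>\<^bsub>braid_group n\<^esub> braid_gen n k
    = pres_cong {1..<n} (braid_rels n) `` {[(i, True), (j, True), (k, True)]}"
  using assms
    pres_mult[of "[(i, True), (j, True)]" "{1..<n}" "[(k, True)]" "braid_rels n"]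
  by (simp add: braid_gen_mult) (simp add: braid_gen_def pres_gen_def braid_group_def words_def)

lemma braid_gen_braid_relation:
  assumes "1 \<le> i" "i + 2 \<le> n"
  shows "braid_gen n i \<otimes>\<^bsub>braid_group n\<^esub> braid_gen n (i+1) \<otimes>\<^bsub>braid_group n\<^esub> braid_gen n i
    = braid_gen n (i+1) \<otimes>\<^bsub>braid_group n\<^esub> braid_gen n i \<otimes>\<^bsub>braid_group n\<^esub> braid_gen n (i+1)"
proof -
  have "i \<in> {1..<n}" "i + 1 \<in> {1..<n}"
    using assms by auto
  then show ?thesis
    unfolding braid_gen_mult3[OF \<open>i \<in> {1..<n}\<close> \<open>i + 1 \<in> {1..<n}\<close> \<open>i \<in> {1..<n}\<close>]
      braid_gen_mult3[OF \<open>i + 1 \<in> {1..<n}\<close> \<open>i \<in> {1..<n}\<close> \<open>i + 1 \<in> {1..<n}\<close>]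
    using assms by (intro pres_cong_class_relation) (auto simp: braid_rels_def words_def)
qed

lemma braid_gen_commute:
  assumes "i \<in> {1..<n}" "j \<in> {1..<n}" "\<bar>int i - int j\<bar> \<ge> 2"
  shows "braid_gen n i \<otimes>\<^bsub>braid_group n\<^esub> braid_gen n j
    = braid_gen n j \<otimes>\<^bsub>braid_group n\<^esub> braid_gen n i"
  unfolding braid_gen_mult[OF assms(1,2)] braid_gen_mult[OF assms(2,1)]
  using assms by (intro pres_cong_class_relation) (auto simp: braid_rels_def words_def)

theorem proposition6p1:
  fixes n :: nat
  shows
    "(let B = braid_group n; \<sigma> = braid_gen n; \<Sigma> = Sigma2 \<sigma>; E = E2 B in
       (\<forall>i. 1 \<le> i \<and> i + 2 \<le> n \<longrightarrow>
          (let q = \<sigma> i \<otimes>\<^bsub>B\<^esub> \<sigma> (i+1) \<otimes>\<^bsub>B\<^esub> \<sigma> i in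
             q = \<sigma> (i+1) \<otimes>\<^bsub>B\<^esub> \<sigma> i \<otimes>\<^bsub>B\<^esub> \<sigma> (i+1) \<and>
             mu3 B (\<Sigma> i (i+1)) (\<Sigma> i (i+1)) (\<Sigma> i (i+1))
               = mu3 B (\<Sigma> (i+1) i) (\<Sigma> (i+1) i) (\<Sigma> (i+1) i) \<and>
             mu3 B (\<Sigma> (i+1) i) (\<Sigma> (i+1) i) (\<Sigma> (i+1) i) = scalar_mult B q E)) \<and>
       (\<forall>i\<in>{1..<n}. \<forall>j\<in>{1..<n}. \<bar>int i - int j\<bar> \<ge> 2 \<longrightarrow>
          mu3 B (\<Sigma> i j) (\<Sigma> i j) E = mu3 B (\<Sigma> j i) (\<Sigma> j i) E)) \<and>
     (\<forall>(G :: 'a monoid) s. group G \<and> s \<in> {1..<n} \<rightarrow> carrier G \<longrightarrow>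
       (let \<Sigma> = Sigma2 s; E = E2 G in
         (\<forall>i. 1 \<le> i \<and> i + 2 \<le> n \<longrightarrow>
            (mu3 G (\<Sigma> i (i+1)) (\<Sigma> i (i+1)) (\<Sigma> i (i+1))
               = mu3 G (\<Sigma> (i+1) i) (\<Sigma> (i+1) i) (\<Sigma> (i+1) i)
             \<longleftrightarrow> s i \<otimes>\<^bsub>G\<^esub> s (i+1) \<otimes>\<^bsub>G\<^esub> s i = s (i+1) \<otimes>\<^bsub>G\<^esub> s i \<otimes>\<^bsub>G\<^esub> s (i+1)) \<and>
            (\<forall>q\<in>carrier G.
               mu3 G (\<Sigma> i (i+1)) (\<Sigma> i (i+1)) (\<Sigma> i (i+1))
                 = mu3 G (\<Sigma> (i+1) i) (\<Sigma> (i+1) i) (\<Sigma> (i+1) i) \<and>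
               mu3 G (\<Sigma> (i+1) i) (\<Sigma> (i+1) i) (\<Sigma> (i+1) i) = scalar_mult G q E
               \<longleftrightarrow> q = s i \<otimes>\<^bsub>G\<^esub> s (i+1) \<otimes>\<^bsub>G\<^esub> s i \<and>
                   q = s (i+1) \<otimes>\<^bsub>G\<^esub> s i \<otimes>\<^bsub>G\<^esub> s (i+1))) \<and>
         (\<forall>i\<in>{1..<n}. \<forall>j\<in>{1..<n}. \<bar>int i - int j\<bar> \<ge> 2 \<longrightarrow>
            (mu3 G (\<Sigma> i j) (\<Sigma> i j) E = mu3 G (\<Sigma> j i) (\<Sigma> j i) E
             \<longleftrightarrow> s i \<otimes>\<^bsub>G\<^esub> s j = s j \<otimes>\<^bsub>G\<^esub> s i))))"
proof -
  interpret B: group "braid_group n"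
    by (rule group_braid_group)
  let ?\<sigma> = "braid_gen n" and ?B = "braid_group n"
  have braid_a:
    "?\<sigma> i \<otimes>\<^bsub>?B\<^esub> ?\<sigma> (i+1) \<otimes>\<^bsub>?B\<^esub> ?\<sigma> i = ?\<sigma> (i+1) \<otimes>\<^bsub>?B\<^esub> ?\<sigma> i \<otimes>\<^bsub>?B\<^esub> ?\<sigma> (i+1) \<and>
     mu3 ?B (Sigma2 ?\<sigma> i (i+1)) (Sigma2 ?\<sigma> i (i+1)) (Sigma2 ?\<sigma> i (i+1))
       = mu3 ?B (Sigma2 ?\<sigma> (i+1) i) (Sigma2 ?\<sigma> (i+1) i) (Sigma2 ?\<sigma> (i+1) i) \<and>
     mu3 ?B (Sigma2 ?\<sigma> (i+1) i) (Sigma2 ?\<sigma> (i+1) i) (Sigma2 ?\<sigma> (i+1) i)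
       = scalar_mult ?B (?\<sigma> i \<otimes>\<^bsub>?B\<^esub> ?\<sigma> (i+1) \<otimes>\<^bsub>?B\<^esub> ?\<sigma> i) (E2 ?B)"
    if "1 \<le> i" "i + 2 \<le> n" for i
  proof -
    have "?\<sigma> i \<otimes>\<^bsub>?B\<^esub> ?\<sigma> (i+1) \<otimes>\<^bsub>?B\<^esub> ?\<sigma> i \<in> carrier ?B"
      using that by (intro B.m_closed braid_gen_in_carrier) auto
    from B.mu3_cube_scalar_iff[OF this, of "?\<sigma> i" "?\<sigma> (i+1)"] show ?thesis
      using braid_gen_braid_relation[OF that] unfolding Sigma2_def by blast
  qed
  have braid_b: "mu3 ?B (Sigma2 ?\<sigma> i j) (Sigma2 ?\<sigma> i j) (E2 ?B)
      = mu3 ?B (Sigma2 ?\<sigma> j i) (Sigma2 ?\<sigma> j i) (E2 ?B)"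
    if "i \<in> {1..<n}" "j \<in> {1..<n}" "\<bar>int i - int j\<bar> \<ge> 2" for i j
    unfolding Sigma2_def
      B.mu3_square_swap_iff[OF braid_gen_in_carrier[OF that(1)] braid_gen_in_carrier[OF that(2)]]
    by (rule braid_gen_commute[OF that])
  have group_a:
    "mu3 G (Sigma2 s i (i+1)) (Sigma2 s i (i+1)) (Sigma2 s i (i+1))
         = mu3 G (Sigma2 s (i+1) i) (Sigma2 s (i+1) i) (Sigma2 s (i+1) i) \<and>
       mu3 G (Sigma2 s (i+1) i) (Sigma2 s (i+1) i) (Sigma2 s (i+1) i) = scalar_mult G q (E2 G)
     \<longleftrightarrow> q = s i \<otimes>\<^bsub>G\<^esub> s (i+1) \<otimes>\<^bsub>G\<^esub> s i \<and> q = s (i+1) \<otimes>\<^bsub>G\<^esub> s i \<otimes>\<^bsub>G\<^esub> s (i+1)"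
    if "group G" "q \<in> carrier G" for G :: "'a monoid" and s i q
    unfolding Sigma2_def
    using that by (intro monoid.mu3_cube_scalar_iff group.is_monoid)
  have group_b: "mu3 G (Sigma2 s i j) (Sigma2 s i j) (E2 G)
        = mu3 G (Sigma2 s j i) (Sigma2 s j i) (E2 G)
      \<longleftrightarrow> s i \<otimes>\<^bsub>G\<^esub> s j = s j \<otimes>\<^bsub>G\<^esub> s i"
    if "group G" "s \<in> {1..<n} \<rightarrow> carrier G" "i \<in> {1..<n}" "j \<in> {1..<n}"
    for G :: "'a monoid" and s i j
    unfolding Sigma2_def
    using that by (intro monoid.mu3_square_swap_iff group.is_monoid) auto
  show ?thesis
    unfolding Let_def
    apply (intro conjI allI impI ballI)
    subgoal for i using braid_a[of i] by blast
    subgoal for i using braid_a[of i] by blast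
    subgoal for i using braid_a[of i] by blast
    subgoal for i j by (rule braid_b)
    subgoal for G s i unfolding Sigma2_def by (rule mu3_cube_swap_iff)
    subgoal for G s i q by (elim conjE) (rule group_a)
    subgoal for G s i j by (elim conjE) (rule group_b)
    done
qed

end
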